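(* Let $L\in\mathbb{N}$, $L\ge 1$. Suppose the function $\psi\in L^2(\mathbb{R})$ has $L$ vanishing moments and $L+1$ absolutely convergent moments, i.e. $\int_{\mathbb{R}}|t|^k|\psi(t)|\,dt<\infty$ for $k=0,\dots,L$ and $\int_{\mathbb{R}}t^k\psi(t)\,dt=0$ for $k=0,\dots,L-1$. Suppose further that $\psi$ is $L$-times continuously differentiable and that all derivatives $\psi^{(k)}$, $k=0,\dots,L$, are integrable on $\mathbb{R}$. Then $\psi\in\mathcal{A}_{w_\rho}$ for every $\rho$ with $0\le\rho<L-\tfrac12$, i.e. $$\int_{\mathbb{R}^*}\int_{\mathbb{R}}|W_\psi\psi(b,a)|\,(|a|^\rho+|a|^{-\rho})\,db\,\frac{da}{a^2}<\infty .$$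
   Context: $\mathbb{R}^*=\mathbb{R}\setminus\{0\}$. The affine group $\mathcal{A}ff$ is $\mathbb{R}\times\mathbb{R}^*$ with $(b_1,a_1)(b_2,a_2)=(b_1+a_1b_2,a_1a_2)$; its left Haar measure is $db\,da/a^2$. For $f,g\in L^2(\mathbb{R})$ the wavelet transform is $W_gf(b,a)=|a|^{-1/2}\int_{\mathbb{R}}f(t)\overline{g\left(\frac{t-b}{a}\right)}\,dt$, $(b,a)\in\mathcal{A}ff$. For $\rho\ge0$, $w_\rho(b,a)=|a|^\rho+|a|^{-\rho}$, and $\mathcal{A}_{w_\rho}=\{\psi\in L^2(\mathbb{R}) : W_\psi\psi\in L^1_{w_\rho}(\mathcal{A}ff)\}$, where $L^1_{w_\rho}(\mathcal{A}ff)$ consists of the measurable $F$ on $\mathcal{A}ff$ with $Fw_\rho$ integrable with respect to $db\,da/a^2$. *)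

theory Defs
  imports "HOL-Analysis.Analysis"
begin

text \<open>
  Elements of \<open>L\<^sup>2(\<real>)\<close> are represented by complex-valued functions rather than by classes modulo
  null sets; all integrals are Lebesgue integrals with respect to the completed measure
  \<^term>\<open>lebesgue\<close>.
\<close>

definition L2 :: "(real \<Rightarrow> complex) set" where
  "L2 = {f \<in> borel_measurable lebesgue. integrable lebesgue (\<lambda>t. (cmod (f t))\<^sup>2)}"

definition Aff :: "(real \<times> real) set" where
  "Aff = UNIV \<times> (UNIV - {0})"

text \<open>The left Haar measure \<open>db da / a\<^sup>2\<close>; a group element is a pair \<open>(b, a)\<close>, translation first.\<close>

definition aff_haar :: "(real \<times> real) measure" where
  "aff_haar = density (restrict_space lebesgue Aff) (\<lambda>(b, a). ennreal (1 / a\<^sup>2))"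

definition wavelet_transform ::
    "(real \<Rightarrow> complex) \<Rightarrow> (real \<Rightarrow> complex) \<Rightarrow> real \<times> real \<Rightarrow> complex" where
  "wavelet_transform g f =
     (\<lambda>(b, a). of_real (\<bar>a\<bar> powr (-1/2)) * (LINT t|lebesgue. f t * cnj (g ((t - b) / a))))"

definition aff_weight :: "real \<Rightarrow> real \<times> real \<Rightarrow> real" where
  "aff_weight \<rho> = (\<lambda>(b, a). \<bar>a\<bar> powr \<rho> + \<bar>a\<bar> powr (- \<rho>))"

definition L1_weighted :: "(real \<times> real \<Rightarrow> real) \<Rightarrow> (real \<times> real \<Rightarrow> complex) set" where
  "L1_weighted w =
     {F \<in> borel_measurable aff_haar. integrable aff_haar (\<lambda>x. F x * of_real (w x))}"

definition analyzing_vectors :: "(real \<times> real \<Rightarrow> real) \<Rightarrow> (real \<Rightarrow> complex) set" where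
  "analyzing_vectors w = {\<psi> \<in> L2. wavelet_transform \<psi> \<psi> \<in> L1_weighted w}"

definition abs_convergent_moment :: "nat \<Rightarrow> (real \<Rightarrow> complex) \<Rightarrow> bool" where
  "abs_convergent_moment k f \<longleftrightarrow> integrable lebesgue (\<lambda>t. \<bar>t\<bar> ^ k * cmod (f t))"

definition vanishing_moment :: "nat \<Rightarrow> (real \<Rightarrow> complex) \<Rightarrow> bool" where
  "vanishing_moment k f \<longleftrightarrow> (LINT t|lebesgue. of_real (t ^ k) * f t) = 0"

text \<open>
  \<^const>\<open>vector_derivative\<close> is the ordinary derivative of a complex-valued function of a real
  variable (\<^const>\<open>deriv\<close> needs domain and codomain to be the same field). It is an arbitrary
  value where the function is not differentiable, so \<open>kth_deriv k f\<close> is only meaningful together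
  with \<open>cont_diff k f\<close>.
\<close>

definition kth_deriv :: "nat \<Rightarrow> (real \<Rightarrow> complex) \<Rightarrow> real \<Rightarrow> complex" where
  "kth_deriv k f = ((\<lambda>g t. vector_derivative g (at t)) ^^ k) f"

definition cont_diff :: "nat \<Rightarrow> (real \<Rightarrow> complex) \<Rightarrow> bool" where
  "cont_diff n f \<longleftrightarrow>
     (\<forall>k<n. \<forall>t. kth_deriv k f differentiable (at t)) \<and> continuous_on UNIV (kth_deriv n f)"

end

theory Submission
  imports Defs
begin

text \<open>
  Substituting \<open>t = b + a s\<close> turns \<open>W\<^sub>\<psi>\<psi>(b, a)\<close> into \<open>\<bar>a\<bar> powr (1/2) * \<integral> cnj (\<psi>(s)) \<psi>(b + a s) ds\<close>. The vanishing
  moments of \<open>\<psi>\<close> allow to replace \<open>\<psi>(b + a s)\<close> by its Taylor remainder of order \<open>L\<close> at \<open>b\<close>. With the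
  integral form of the remainder and Tonelli's theorem, the \<open>L\<^sup>1\<close> norm in \<open>b\<close> is at most
  \<open>C \<bar>a\<bar> powr (L + 1/2)\<close>, where \<open>C\<close> is the \<open>L\<close>-th absolute moment of \<open>\<psi>\<close> times the \<open>L\<^sup>1\<close> norm of
  the \<open>L\<close>-th derivative. Expanding the other factor \<open>\<psi>((t - b) / a)\<close> at \<open>- b / a\<close> instead gives the bound
  \<open>C \<bar>a\<bar> powr (1/2 - L)\<close>. The first bound is integrable against \<open>w\<^sub>\<rho>(a) da / a\<^sup>2\<close> near \<open>0\<close> exactly when
  \<open>\<rho> < L - 1/2\<close>, and the second one is integrable near infinity when \<open>\<rho> < L + 1/2\<close>.
\<close>

section \<open>Taylor's formula and correlations with functions that have vanishing moments\<close>

lemma kth_deriv_0 [simp]: "kth_deriv 0 f = f"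
  by (simp add: kth_deriv_def)

lemma cont_diff_has_vector_derivative:
  assumes "cont_diff n f" "k < n"
  shows "(kth_deriv k f has_vector_derivative kth_deriv (Suc k) f t) (at t)"
  using assms by (auto simp: cont_diff_def kth_deriv_def vector_derivative_works)

lemma cont_diff_continuous_kth_deriv:
  assumes "cont_diff n f" "k \<le> n"
  shows "continuous_on UNIV (kth_deriv k f)"
proof (cases "k = n")
  case False
  with assms have "kth_deriv k f differentiable (at t)" for t
    by (auto simp: cont_diff_def)
  then show ?thesis
    by (simp add: continuous_at_imp_continuous_on differentiable_imp_continuous_within)
qed (use assms in \<open>auto simp: cont_diff_def\<close>)

text \<open>Taylor's formula yields a gauge integral, while Tonelli's theorem works with nonnegative
  Lebesgue integrals; this is the bridge between the two.\<close>

lemma nn_integral_eq_integral_Icc: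
  fixes g :: "real \<Rightarrow> real"
  assumes "continuous_on {a..b} g" "\<And>u. 0 \<le> g u"
  shows "ennreal (integral {a..b} g) = (\<integral>\<^sup>+u\<in>{a..b}. ennreal (g u) \<partial>lborel)"
proof -
  have int: "set_integrable lborel {a..b} g"
    using assms(1) by (rule borel_integrable_atLeastAtMost')
  have "integral {a..b} g = (LINT u:{a..b}|lborel. g u)"
    using set_borel_integral_eq_integral(2)[OF int] by simp
  also have "ennreal \<dots> = (\<integral>\<^sup>+u. ennreal (indicator {a..b} u * g u) \<partial>lborel)"
    using int assms(2) unfolding set_integrable_def set_lebesgue_integral_def
    by (subst nn_integral_eq_integral) auto
  also have "\<dots> = (\<integral>\<^sup>+u\<in>{a..b}. ennreal (g u) \<partial>lborel)"
    by (intro nn_integral_cong) (auto split: split_indicator)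
  finally show ?thesis .
qed

text \<open>Taylor's formula is applied to \<open>u \<mapsto> f (x + u * h)\<close> on
  \<open>{0..1}\<close>, which treats both signs of \<open>h\<close> at once. The kernel
  \<open>(1 - u) ^ (n - 1) / fact (n - 1)\<close> of the remainder is at most 1 and is
  dropped.\<close>

lemma Taylor_remainder_le:
  assumes f: "cont_diff n f" and "n \<ge> 1"
  shows "ennreal (cmod (f (x + h) - (\<Sum>k<n. (h ^ k / fact k) *\<^sub>R kth_deriv k f x)))
    \<le> ennreal (\<bar>h\<bar> ^ n) * (\<integral>\<^sup>+u\<in>{0..1}. ennreal (cmod (kth_deriv n f (x + u * h))) \<partial>lborel)"
proof -
  \<comment> \<open>\<open>D m\<close> is the derivative of order \<open>m\<close> of
    \<open>u \<mapsto> f (x + u * h)\<close>; each differentiation contributes one factor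
    \<open>h\<close>.\<close>
  define D where "D m u = h ^ m *\<^sub>R kth_deriv m f (x + u * h)" for m u
  define i where "i = (\<lambda>u. ((1 - u) ^ (n - 1) / fact (n - 1)) *\<^sub>R D n u)"
  define g where "g = (\<lambda>u. \<bar>h\<bar> ^ n * cmod (kth_deriv n f (x + u * h)))"
  have cont: "continuous_on S (\<lambda>u. kth_deriv n f (x + u * h))" for S
    by (rule continuous_on_compose2[OF cont_diff_continuous_kth_deriv[OF f order_refl]])
       (auto intro!: continuous_intros)
  have der: "(D m has_vector_derivative D (Suc m) t) (at t within {0..1})" if "m < n" for m t
  proof -
    have "((\<lambda>u. x + u * h) has_vector_derivative h) (at t within {0..1})"
      by (auto intro!: derivative_eq_intros simp: has_vector_derivative_def)
    moreover have "(kth_deriv m f has_vector_derivative kth_deriv (Suc m) f (x + t * h))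
        (at (x + t * h) within (\<lambda>u. x + u * h) ` {0..1})"
      using cont_diff_has_vector_derivative[OF f that] has_vector_derivative_at_within by blast
    ultimately have "((kth_deriv m f \<circ> (\<lambda>u. x + u * h)) has_vector_derivative
        h *\<^sub>R kth_deriv (Suc m) f (x + t * h)) (at t within {0..1})"
      by (rule vector_diff_chain_within)
    then have "((\<lambda>u. h ^ m *\<^sub>R kth_deriv m f (x + u * h)) has_vector_derivative
        h ^ m *\<^sub>R h *\<^sub>R kth_deriv (Suc m) f (x + t * h)) (at t within {0..1})"
      using bounded_linear.has_vector_derivative[OF bounded_linear_scaleR_right]
      by (fastforce simp: o_def)
    then show ?thesis
      by (simp add: D_def[abs_def] mult.commute)
  qed
  have "(i has_integral D 0 1 - (\<Sum>k<n. ((1 - 0) ^ k / fact k) *\<^sub>R D k 0)) {0..1}"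
    unfolding i_def by (rule Taylor_has_integral) (use \<open>n \<ge> 1\<close> der in auto)
  then have i: "(i has_integral f (x + h) - (\<Sum>k<n. (h ^ k / fact k) *\<^sub>R kth_deriv k f x)) {0..1}"
    by (simp add: D_def)
  have g: "continuous_on {0..1} g"
    unfolding g_def by (intro continuous_intros cont)
  have "cmod (i u) \<le> g u" if "u \<in> {0..1}" for u
  proof -
    define q where "q = (1 - u) ^ (n - 1) / fact (n - 1)"
    have "0 \<le> q" "q \<le> 1"
      using that fact_ge_1[of "n - 1", where 'a=real]
      by (simp_all add: q_def divide_le_eq power_le_one order_trans[OF power_le_one])
    then show ?thesis
      unfolding i_def D_def g_def q_def[symmetric]
      by (simp add: abs_mult power_abs mult.assoc mult_left_le_one_le)
  qed
  then have "cmod (integral {0..1} i) \<le> integral {0..1} g"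
    using i integrable_continuous_real[OF g] by (intro integral_norm_bound_integral) auto
  then have "ennreal (cmod (f (x + h) - (\<Sum>k<n. (h ^ k / fact k) *\<^sub>R kth_deriv k f x)))
      \<le> ennreal (integral {0..1} g)"
    using i by (simp add: integral_unique ennreal_leI)
  also have "\<dots> = (\<integral>\<^sup>+u\<in>{0..1}. ennreal (g u) \<partial>lborel)"
    by (rule nn_integral_eq_integral_Icc[OF g]) (simp add: g_def)
  also have "\<dots> = (\<integral>\<^sup>+u. ennreal (\<bar>h\<bar> ^ n) *
      (ennreal (cmod (kth_deriv n f (x + u * h))) * indicator {0..1} u) \<partial>lborel)"
    by (simp add: g_def ennreal_mult mult.assoc)
  also have "\<dots> = ennreal (\<bar>h\<bar> ^ n) *
      (\<integral>\<^sup>+u\<in>{0..1}. ennreal (cmod (kth_deriv n f (x + u * h))) \<partial>lborel)"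
    using borel_measurable_continuous_onI[OF cont]
    by (intro nn_integral_cmult) auto
  finally show ?thesis .
qed

text \<open>If the integrand on the left is not integrable, the Bochner integral has the junk value \<open>0\<close>.\<close>

lemma cmod_correlation_le:
  assumes f: "cont_diff n f" and n: "n \<ge> 1"
    and g [measurable]: "g \<in> borel_measurable borel"
    and mom: "\<And>k. k < n \<Longrightarrow> abs_convergent_moment k g"
    and van: "\<And>k. k < n \<Longrightarrow> vanishing_moment k g"
  shows "ennreal (cmod (LINT s|lborel. g s * f (x + c * s)))
    \<le> (\<integral>\<^sup>+s. ennreal (cmod (g s) * \<bar>c * s\<bar> ^ n) *
        (\<integral>\<^sup>+u\<in>{0..1}. ennreal (cmod (kth_deriv n f (x + u * (c * s)))) \<partial>lborel) \<partial>lborel)"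
proof (cases "integrable lborel (\<lambda>s. g s * f (x + c * s))")
  case True
  \<comment> \<open>The Taylor polynomial of \<open>f\<close> at \<open>x\<close> with increment
    \<open>c * s\<close>. As a polynomial in \<open>s\<close> it has degree below \<open>n\<close>,
    so its product with \<open>g\<close> integrates to 0 and can be subtracted without changing the
    correlation.\<close>
  define T where "T s = (\<Sum>k<n. ((c * s) ^ k / fact k) *\<^sub>R kth_deriv k f x)" for s
  have mom': "integrable lborel (\<lambda>s. of_real (s ^ k) * g s)" if "k < n" for k
  proof -
    have "integrable lborel (\<lambda>s. \<bar>s\<bar> ^ k * cmod (g s))"
      using mom[OF that] by (simp add: abs_convergent_moment_def integrable_completion)
    then show ?thesis
      by (rule Bochner_Integration.integrable_bound) (auto simp: norm_mult norm_power)
  qed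
  have van': "(LINT s|lborel. of_real (s ^ k) * g s) = 0" if "k < n" for k
    using van[OF that] by (simp add: vanishing_moment_def integral_completion)
  have gT: "g s * T s =
      (\<Sum>k<n. of_real (c ^ k / fact k) * kth_deriv k f x * (of_real (s ^ k) * g s))" for s
    by (auto simp: T_def sum_distrib_left power_mult_distrib scaleR_conv_of_real
        intro!: sum.cong)
  have T_int: "integrable lborel (\<lambda>s. g s * T s)"
    unfolding gT using mom' by (intro Bochner_Integration.integrable_sum integrable_mult_right) auto
  have "(LINT s|lborel. g s * T s) = 0"
    unfolding gT using mom' van' by (subst Bochner_Integration.integral_sum) auto
  then have "(LINT s|lborel. g s * f (x + c * s)) = (LINT s|lborel. g s * f (x + c * s) - g s * T s)"
    using True T_int by (subst Bochner_Integration.integral_diff) auto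
  also have "ennreal (cmod \<dots>) \<le> (\<integral>\<^sup>+s. ennreal (cmod (g s * f (x + c * s) - g s * T s)) \<partial>lborel)"
    using True T_int by (intro integral_norm_bound_ennreal) auto
  also have "\<dots> \<le> (\<integral>\<^sup>+s. ennreal (cmod (g s) * \<bar>c * s\<bar> ^ n) *
        (\<integral>\<^sup>+u\<in>{0..1}. ennreal (cmod (kth_deriv n f (x + u * (c * s)))) \<partial>lborel) \<partial>lborel)"
  proof (rule nn_integral_mono)
    fix s
    have "ennreal (cmod (g s * f (x + c * s) - g s * T s)) =
        ennreal (cmod (g s)) * ennreal (cmod (f (x + c * s) - T s))"
      by (simp add: norm_mult ennreal_mult flip: right_diff_distrib)
    also have "\<dots> \<le> ennreal (cmod (g s)) * (ennreal (\<bar>c * s\<bar> ^ n) *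
        (\<integral>\<^sup>+u\<in>{0..1}. ennreal (cmod (kth_deriv n f (x + u * (c * s)))) \<partial>lborel))"
      unfolding T_def by (intro mult_left_mono Taylor_remainder_le f n) simp
    finally show "ennreal (cmod (g s * f (x + c * s) - g s * T s)) \<le>
        ennreal (cmod (g s) * \<bar>c * s\<bar> ^ n) *
        (\<integral>\<^sup>+u\<in>{0..1}. ennreal (cmod (kth_deriv n f (x + u * (c * s)))) \<partial>lborel)"
      by (simp add: ennreal_mult mult.assoc)
  qed
  finally show ?thesis .
qed (simp add: not_integrable_integral_eq)

text \<open>After Tonelli the integral over \<open>x\<close> is innermost. Translation invariance
  removes the shift \<open>u * (c * s)\<close> from the derivative, so its norm factors out and only
  the absolute moment of \<open>g\<close> of order \<open>n\<close> remains.\<close>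

lemma nn_integral_correlation_le:
  assumes f: "cont_diff n f" and n: "n \<ge> 1"
    and g [measurable]: "g \<in> borel_measurable borel"
    and mom: "\<And>k. k < n \<Longrightarrow> abs_convergent_moment k g"
    and van: "\<And>k. k < n \<Longrightarrow> vanishing_moment k g"
  shows "(\<integral>\<^sup>+x. ennreal (cmod (LINT s|lborel. g s * f (x + c * s))) \<partial>lborel)
    \<le> ennreal (\<bar>c\<bar> ^ n) * ((\<integral>\<^sup>+s. ennreal (\<bar>s\<bar> ^ n * cmod (g s)) \<partial>lborel) *
        (\<integral>\<^sup>+x. ennreal (cmod (kth_deriv n f x)) \<partial>lborel))"
proof -
  define F where "F = (\<lambda>x. ennreal (cmod (kth_deriv n f x)))"
  have [measurable]: "kth_deriv n f \<in> borel_measurable borel"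
    by (rule borel_measurable_continuous_onI[OF cont_diff_continuous_kth_deriv[OF f order_refl]])
  have [measurable]: "F \<in> borel_measurable borel"
    unfolding F_def by measurable
  have trans: "(\<integral>\<^sup>+x. F (x + y) \<partial>lborel) = (\<integral>\<^sup>+x. F x \<partial>lborel)" for y
    using nn_integral_real_affine[of F 1 y] by (simp add: add.commute)
  \<comment> \<open>Averaging over translates by \<open>u * y\<close> preserves the total integral
    because \<open>{0..1}\<close> has length 1.\<close>
  have avg: "(\<integral>\<^sup>+x. (\<integral>\<^sup>+u\<in>{0..1}. F (x + u * y) \<partial>lborel) \<partial>lborel) = (\<integral>\<^sup>+x. F x \<partial>lborel)" for y
  proof -
    have "(\<integral>\<^sup>+x. (\<integral>\<^sup>+u\<in>{0..1}. F (x + u * y) \<partial>lborel) \<partial>lborel) =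
        (\<integral>\<^sup>+u. (\<integral>\<^sup>+x. F (x + u * y) * indicator {0..1} u \<partial>lborel) \<partial>lborel)"
      by (rule lborel_pair.Fubini') measurable
    also have "\<dots> = (\<integral>\<^sup>+u. (\<integral>\<^sup>+x. F x \<partial>lborel) * indicator {0..1::real} u \<partial>lborel)"
      by (simp add: nn_integral_multc trans)
    finally show ?thesis
      by (simp add: nn_integral_cmult_indicator)
  qed
  have "(\<integral>\<^sup>+x. ennreal (cmod (LINT s|lborel. g s * f (x + c * s))) \<partial>lborel)
      \<le> (\<integral>\<^sup>+x. (\<integral>\<^sup>+s. ennreal (cmod (g s) * \<bar>c * s\<bar> ^ n) *
          (\<integral>\<^sup>+u\<in>{0..1}. F (x + u * (c * s)) \<partial>lborel) \<partial>lborel) \<partial>lborel)"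
    unfolding F_def by (intro nn_integral_mono cmod_correlation_le f n g mom van)
  also have "\<dots> = (\<integral>\<^sup>+s. (\<integral>\<^sup>+x. ennreal (cmod (g s) * \<bar>c * s\<bar> ^ n) *
          (\<integral>\<^sup>+u\<in>{0..1}. F (x + u * (c * s)) \<partial>lborel) \<partial>lborel) \<partial>lborel)"
    by (rule lborel_pair.Fubini') measurable
  also have "\<dots> = (\<integral>\<^sup>+s. ennreal (cmod (g s) * \<bar>c * s\<bar> ^ n) * (\<integral>\<^sup>+x. F x \<partial>lborel) \<partial>lborel)"
    by (simp add: nn_integral_cmult avg)
  also have "\<dots> = (\<integral>\<^sup>+s. ennreal (\<bar>c\<bar> ^ n) * (ennreal (\<bar>s\<bar> ^ n * cmod (g s)) *
      (\<integral>\<^sup>+x. F x \<partial>lborel)) \<partial>lborel)"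
    by (simp add: abs_mult power_mult_distrib ennreal_mult mult_ac)
  also have "\<dots> = ennreal (\<bar>c\<bar> ^ n) * ((\<integral>\<^sup>+s. ennreal (\<bar>s\<bar> ^ n * cmod (g s)) \<partial>lborel) *
      (\<integral>\<^sup>+x. F x \<partial>lborel))"
    by (simp add: nn_integral_cmult nn_integral_multc)
  finally show ?thesis
    by (simp add: F_def)
qed

section \<open>Nonnegative integrals over the real line\<close>

lemma nn_integral_abs_le:
  fixes F :: "real \<Rightarrow> ennreal"
  assumes [measurable]: "F \<in> borel_measurable borel"
  shows "(\<integral>\<^sup>+a. F \<bar>a\<bar> \<partial>lborel) \<le> 2 * (\<integral>\<^sup>+a\<in>{0..}. F a \<partial>lborel)"
proof -
  have "(\<integral>\<^sup>+a. F \<bar>a\<bar> \<partial>lborel)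
      \<le> (\<integral>\<^sup>+a. F a * indicator {0..} a + F (0 + (-1) * a) * indicator {0..} (0 + (-1) * a) \<partial>lborel)"
    by (intro nn_integral_mono) (auto split: split_indicator)
  also have "\<dots> = (\<integral>\<^sup>+a\<in>{0..}. F a \<partial>lborel) +
      (\<integral>\<^sup>+a. F (0 + (-1) * a) * indicator {0..} (0 + (-1) * a) \<partial>lborel)"
    by (rule nn_integral_add) measurable
  also have "(\<integral>\<^sup>+a. F (0 + (-1) * a) * indicator {0..} (0 + (-1) * a) \<partial>lborel) =
      (\<integral>\<^sup>+a\<in>{0..}. F a \<partial>lborel)"
    using nn_integral_real_affine[of "\<lambda>a. F a * indicator {0..} a" "-1" 0] by simp
  finally show ?thesis
    by (simp add: mult_2)
qed

text \<open>Makes the known gauge integrals of powers over \<open>{0..1}\<close> and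
  \<open>{1..}\<close> usable for nonnegative Lebesgue integrals.\<close>

lemma set_nn_integral_finite_if_has_integral:
  fixes f :: "real \<Rightarrow> real"
  assumes [measurable]: "f \<in> borel_measurable borel" "S \<in> sets borel"
    and "\<And>x. 0 \<le> f x" and "(f has_integral r) S"
  shows "(\<integral>\<^sup>+x\<in>S. ennreal (f x) \<partial>lborel) < \<infinity>"
proof -
  have "(\<lambda>x. f x * indicator S x) = (\<lambda>x. if x \<in> S then f x else 0)"
    by (auto split: split_indicator)
  then have "((\<lambda>x. f x * indicator S x) has_integral r) UNIV"
    using assms(4) by (simp add: has_integral_restrict_UNIV)
  from nn_integral_has_integral_lborel[OF _ _ this]
  have "(\<integral>\<^sup>+x. ennreal (f x * indicator S x) \<partial>lborel) < \<infinity>"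
    using assms(3) by simp
  then show ?thesis
    using assms(3) by (simp add: ennreal_mult ennreal_indicator)
qed

section \<open>The wavelet transform as a correlation, its weight and the Haar measure\<close>

lemma borel_measurable_cnj [measurable]: "cnj \<in> borel_measurable borel"
  by (intro borel_measurable_continuous_onI continuous_intros)

lemma wavelet_transform_lborel:
  assumes [measurable]: "f \<in> borel_measurable borel" "g \<in> borel_measurable borel"
  shows "wavelet_transform g f (b, a) =
    of_real (\<bar>a\<bar> powr (-1/2)) * (LINT t|lborel. f t * cnj (g ((t - b) / a)))"
  by (simp add: wavelet_transform_def integral_completion)

lemma borel_measurable_wavelet_transform:
  assumes [measurable]: "f \<in> borel_measurable borel" "g \<in> borel_measurable borel"
  shows "wavelet_transform g f \<in> borel_measurable borel"
proof -
  have "wavelet_transform g f = (\<lambda>x. of_real (\<bar>snd x\<bar> powr (-1/2)) *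
      (LINT t|lborel. f t * cnj (g ((t - fst x) / snd x))))"
    using wavelet_transform_lborel[OF assms] by (auto simp: fun_eq_iff)
  also have "\<dots> \<in> borel_measurable (borel \<Otimes>\<^sub>M borel)"
    by measurable
  finally show ?thesis
    by (simp add: borel_prod)
qed

text \<open>The substitution \<open>t = b + a * s\<close> has Jacobian \<open>\<bar>a\<bar>\<close>,
  which turns the exponent -1/2 into 1/2. Now \<open>f\<close> is the factor to be expanded, with
  scale \<open>a\<close>.\<close>

lemma wavelet_transform_eq_correlation:
  assumes [measurable]: "f \<in> borel_measurable borel" "g \<in> borel_measurable borel"
    and "a \<noteq> 0"
  shows "wavelet_transform g f (b, a) =
    of_real (\<bar>a\<bar> powr (1/2)) * (LINT s|lborel. cnj (g s) * f (b + a * s))"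
proof -
  have "(LINT t|lborel. f t * cnj (g ((t - b) / a))) =
      \<bar>a\<bar> *\<^sub>R (LINT s|lborel. f (b + a * s) * cnj (g ((b + a * s - b) / a)))"
    by (rule lborel_integral_real_affine[OF \<open>a \<noteq> 0\<close>])
  also have "\<dots> = of_real \<bar>a\<bar> * (LINT s|lborel. cnj (g s) * f (b + a * s))"
    using \<open>a \<noteq> 0\<close> by (simp add: scaleR_conv_of_real mult.commute)
  finally have "wavelet_transform g f (b, a) =
      of_real (\<bar>a\<bar> powr (-1/2) * \<bar>a\<bar>) * (LINT s|lborel. cnj (g s) * f (b + a * s))"
    by (simp add: wavelet_transform_lborel)
  also have "\<bar>a\<bar> powr (-1/2) * \<bar>a\<bar> = \<bar>a\<bar> powr (1/2)"
    using powr_mult_base[of "\<bar>a\<bar>" "-1/2"] by (simp add: mult.commute)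
  finally show ?thesis .
qed

text \<open>Conjugating the integral exchanges the roles of the factors: \<open>g\<close> is now the
  one to be expanded, at the point \<open>- b / a\<close> with scale \<open>1 / a\<close>. The
  summand 0 prepares the affine substitution in \<open>b\<close>.\<close>

lemma cmod_wavelet_transform_swap:
  assumes [measurable]: "f \<in> borel_measurable borel" "g \<in> borel_measurable borel"
  shows "cmod (wavelet_transform g f (b, a)) =
    \<bar>a\<bar> powr (-1/2) * cmod (LINT t|lborel. cnj (f t) * g (0 + (- 1 / a) * b + (1 / a) * t))"
proof -
  have "(LINT t|lborel. f t * cnj (g ((t - b) / a))) =
      cnj (LINT t|lborel. cnj (f t) * g (0 + (- 1 / a) * b + (1 / a) * t))"
    by (simp add: diff_divide_distrib flip: Bochner_Integration.integral_cnj)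
  then show ?thesis
    by (simp add: wavelet_transform_lborel norm_mult)
qed

text \<open>The weight is at most twice its larger term, \<open>r powr (- \<rho>)\<close> for
  \<open>r \<le> 1\<close> and \<open>r powr \<rho>\<close> beyond. The first bound on
  \<open>h\<close> is used in the former range and the second in the latter.\<close>

lemma weighted_powr_bound:
  fixes r d \<rho> :: real
  assumes "0 < r" "0 \<le> \<rho>" and h: "h \<le> ennreal (r powr (d + 1/2)) * C"
    "h \<le> ennreal (r powr (1/2 - d)) * C"
  shows "h * ennreal (r powr \<rho> + r powr (- \<rho>)) * ennreal (1 / r\<^sup>2) \<le>
    2 * C * (ennreal (r powr (d - 3/2 - \<rho>)) * indicator {0..1} r +
             ennreal (r powr (- 3/2 - d + \<rho>)) * indicator {1..} r)"
proof -
  have r2: "1 / r\<^sup>2 = r powr (-2)"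
    using \<open>0 < r\<close> by (simp add: powr_minus_divide powr_numeral)
  \<comment> \<open>Here \<open>e\<close> is the exponent of the bound on \<open>h\<close>,
    \<open>\<sigma>\<close> that of the dominant term of the weight, and -2 comes from the Haar
    density.\<close>
  have main: "h * ennreal (r powr \<rho> + r powr (- \<rho>)) * ennreal (1 / r\<^sup>2) \<le>
      2 * C * ennreal (r powr (e + \<sigma> - 2))"
    if "h \<le> ennreal (r powr e) * C" and w: "r powr \<rho> + r powr (- \<rho>) \<le> 2 * r powr \<sigma>" for e \<sigma>
  proof -
    have "h * ennreal (r powr \<rho> + r powr (- \<rho>)) * ennreal (1 / r\<^sup>2) \<le>
        (ennreal (r powr e) * C) * ennreal (2 * r powr \<sigma>) * ennreal (r powr (-2))"
      using that by (intro mult_mono ennreal_leI) (auto simp: r2)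
    also have "\<dots> = 2 * C * ennreal (r powr e * r powr \<sigma> * r powr (-2))"
      by (simp add: ennreal_mult mult_ac)
    also have "r powr e * r powr \<sigma> * r powr (-2) = r powr (e + \<sigma> - 2)"
      by (simp flip: powr_add)
    finally show ?thesis .
  qed
  show ?thesis
  proof (cases "r \<le> 1")
    case True
    then have "r powr \<rho> \<le> r powr (- \<rho>)"
      using assms by (intro powr_mono') auto
    then have "h * ennreal (r powr \<rho> + r powr (- \<rho>)) * ennreal (1 / r\<^sup>2) \<le>
        2 * C * ennreal (r powr (d - 3/2 - \<rho>))"
      using main[OF h(1), of "-\<rho>"] by (simp add: algebra_simps)
    also have "\<dots> \<le> 2 * C * (ennreal (r powr (d - 3/2 - \<rho>)) * indicator {0..1} r +
             ennreal (r powr (- 3/2 - d + \<rho>)) * indicator {1..} r)"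
      using True \<open>0 < r\<close> by (intro mult_left_mono) auto
    finally show ?thesis .
  next
    case False
    then have "r powr (- \<rho>) \<le> r powr \<rho>"
      using assms by (intro powr_mono) auto
    then have "h * ennreal (r powr \<rho> + r powr (- \<rho>)) * ennreal (1 / r\<^sup>2) \<le>
        2 * C * ennreal (r powr (- 3/2 - d + \<rho>))"
      using main[OF h(2), of \<rho>] by (simp add: algebra_simps)
    also have "\<dots> \<le> 2 * C * (ennreal (r powr (d - 3/2 - \<rho>)) * indicator {0..1} r +
             ennreal (r powr (- 3/2 - d + \<rho>)) * indicator {1..} r)"
      using False by (intro mult_left_mono) auto
    finally show ?thesis .
  qed
qed

text \<open>The completed measure is replaced by \<open>lborel\<close> on the plane, a product
  measure, where Tonelli's theorem puts the integral over \<open>b\<close> inside. The restriction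
  to \<open>Aff\<close> survives as an indicator in \<open>a\<close>.\<close>

lemma nn_integral_aff_haar:
  assumes [measurable]: "F \<in> borel_measurable borel"
  shows "(\<integral>\<^sup>+x. F x \<partial>aff_haar) =
    (\<integral>\<^sup>+a\<in>UNIV - {0}. (\<integral>\<^sup>+b. F (b, a) \<partial>lborel) * ennreal (1 / a\<^sup>2) \<partial>lborel)"
proof -
  have [measurable]: "F \<in> borel_measurable (borel \<Otimes>\<^sub>M borel)"
    by (simp add: borel_prod)
  have Aff: "Aff \<in> sets borel"
    unfolding Aff_def by (intro borel_open open_Times) auto
  have dens: "(\<lambda>(b::real, a). ennreal (1 / a\<^sup>2)) \<in> borel_measurable (borel \<Otimes>\<^sub>M borel)"
    by measurable
  have meas: "G \<in> borel_measurable (restrict_space lebesgue Aff)"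
    if "G \<in> borel_measurable borel" for G :: "real \<times> real \<Rightarrow> ennreal"
    using that by (intro measurable_restrict_space1 measurable_completion) simp
  have "(\<integral>\<^sup>+x. F x \<partial>aff_haar) =
      (\<integral>\<^sup>+x. (case x of (b, a) \<Rightarrow> ennreal (1 / a\<^sup>2)) * F x \<partial>restrict_space lebesgue Aff)"
    unfolding aff_haar_def using dens
    by (intro nn_integral_density meas) (simp_all add: borel_prod)
  also have "\<dots> = (\<integral>\<^sup>+x. (case x of (b, a) \<Rightarrow> ennreal (1 / a\<^sup>2)) * F x * indicator Aff x \<partial>lborel)"
    using Aff by (subst nn_integral_restrict_space) (auto simp: nn_integral_completion)
  also have "\<dots> = (\<integral>\<^sup>+x. F x * ennreal (1 / (snd x)\<^sup>2) * indicator (UNIV - {0}) (snd x)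
      \<partial>(lborel \<Otimes>\<^sub>M lborel))"
    unfolding lborel_prod
    by (intro nn_integral_cong) (auto simp: Aff_def mult.commute split: split_indicator)
  also have "\<dots> = (\<integral>\<^sup>+a. (\<integral>\<^sup>+b. F (b, a) * ennreal (1 / a\<^sup>2) * indicator (UNIV - {0}) a
      \<partial>lborel) \<partial>lborel)"
    by (subst lborel_pair.nn_integral_snd[symmetric]) auto
  also have "\<dots> = (\<integral>\<^sup>+a\<in>UNIV - {0}. (\<integral>\<^sup>+b. F (b, a) \<partial>lborel) * ennreal (1 / a\<^sup>2) \<partial>lborel)"
    by (simp add: nn_integral_multc)
  finally show ?thesis .
qed


section \<open>Norm bounds in the translation, then integration over the scale\<close>

theorem proposition4p1p10:
  fixes L :: nat and \<psi> :: "real \<Rightarrow> complex" and \<rho> :: real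
  assumes "L \<ge> 1"
    and "\<psi> \<in> L2"
    and "\<And>k. k \<le> L \<Longrightarrow> abs_convergent_moment k \<psi>"
    and "\<And>k. k < L \<Longrightarrow> vanishing_moment k \<psi>"
    and "cont_diff L \<psi>"
    and "\<And>k. k \<le> L \<Longrightarrow> integrable lebesgue (kth_deriv k \<psi>)"
    and "0 \<le> \<rho>" and "\<rho> < real L - 1/2"
  shows "\<psi> \<in> analyzing_vectors (aff_weight \<rho>) \<and>
    (\<integral>\<^sup>+a\<in>UNIV - {0}. (\<integral>\<^sup>+b. ennreal (cmod (wavelet_transform \<psi> \<psi> (b, a)) *
        (\<bar>a\<bar> powr \<rho> + \<bar>a\<bar> powr (- \<rho>))) \<partial>lebesgue) * ennreal (1 / a\<^sup>2) \<partial>lebesgue) < \<infinity>"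
proof -
  define W where "W = wavelet_transform \<psi> \<psi>"
  define C where "C = (\<integral>\<^sup>+s. ennreal (\<bar>s\<bar> ^ L * cmod (\<psi> s)) \<partial>lborel) *
    (\<integral>\<^sup>+x. ennreal (cmod (kth_deriv L \<psi> x)) \<partial>lborel)"
  define H where "H a = (\<integral>\<^sup>+b. ennreal (cmod (W (b, a))) \<partial>lborel)" for a
  define I where "I x c = (LINT s|lborel. cnj (\<psi> s) * \<psi> (x + c * s))" for x c
  \<comment> \<open>Continuity makes \<psi> Borel measurable, so that \<open>lborel\<close> can
    stand in for \<open>lebesgue\<close> in the integrals.\<close>
  have \<psi> [measurable]: "\<psi> \<in> borel_measurable borel"
    using borel_measurable_continuous_onI[OF cont_diff_continuous_kth_deriv[OF assms(5), of 0]]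
    by simp
  have cnj_\<psi> [measurable]: "(\<lambda>s. cnj (\<psi> s)) \<in> borel_measurable borel"
    by measurable
  have W_meas [measurable]: "W \<in> borel_measurable borel"
    unfolding W_def by (rule borel_measurable_wavelet_transform[OF \<psi> \<psi>])
  have I_meas [measurable]: "(\<lambda>x. I x c) \<in> borel_measurable borel" for c
    unfolding I_def by measurable

  have "(\<integral>\<^sup>+s. ennreal (\<bar>s\<bar> ^ L * cmod (\<psi> s)) \<partial>lborel) < \<infinity>"
    using assms(3)[of L]
    by (simp add: abs_convergent_moment_def integrable_iff_bounded nn_integral_completion)
  moreover have "(\<integral>\<^sup>+x. ennreal (cmod (kth_deriv L \<psi> x)) \<partial>lborel) < \<infinity>"
    using assms(6)[of L] by (simp add: integrable_iff_bounded nn_integral_completion)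
  ultimately have C: "C < \<infinity>"
    unfolding C_def by (simp add: ennreal_mult_less_top)

  \<comment> \<open>One bound serves both regimes: \<open>c = a\<close> gives \<open>H_small\<close>
    and \<open>c = 1 / a\<close> gives \<open>H_large\<close>. Conjugation preserves the moment
    conditions.\<close>
  have I_le: "(\<integral>\<^sup>+x. ennreal (cmod (I x c)) \<partial>lborel) \<le> ennreal (\<bar>c\<bar> ^ L) * C" for c
  proof -
    have mom: "abs_convergent_moment k (\<lambda>s. cnj (\<psi> s))" if "k < L" for k
      using assms(3)[of k] that by (simp add: abs_convergent_moment_def)
    have van: "vanishing_moment k (\<lambda>s. cnj (\<psi> s))" if "k < L" for k
    proof -
      have "(LINT t|lebesgue. of_real (t ^ k) * cnj (\<psi> t)) =
          cnj (LINT t|lebesgue. of_real (t ^ k) * \<psi> t)"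
        by (simp flip: Bochner_Integration.integral_cnj)
      then show ?thesis
        using assms(4)[OF that] by (simp add: vanishing_moment_def)
    qed
    show ?thesis
      using nn_integral_correlation_le[OF assms(5,1) cnj_\<psi> mom van, of c]
      by (simp add: I_def C_def)
  qed

  have H_small: "H a \<le> ennreal (\<bar>a\<bar> powr (real L + 1/2)) * C" if "a \<noteq> 0" for a
  proof -
    have "H a = (\<integral>\<^sup>+b. ennreal (\<bar>a\<bar> powr (1/2)) * ennreal (cmod (I b a)) \<partial>lborel)"
      unfolding H_def W_def I_def
      by (simp add: wavelet_transform_eq_correlation[OF \<psi> \<psi> that] norm_mult ennreal_mult)
    also have "\<dots> = ennreal (\<bar>a\<bar> powr (1/2)) * (\<integral>\<^sup>+b. ennreal (cmod (I b a)) \<partial>lborel)"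
      by (rule nn_integral_cmult) measurable
    also have "\<dots> \<le> ennreal (\<bar>a\<bar> powr (1/2)) * (ennreal (\<bar>a\<bar> ^ L) * C)"
      by (intro mult_left_mono I_le) simp
    also have "\<dots> = ennreal (\<bar>a\<bar> powr (1/2) * \<bar>a\<bar> powr real L) * C"
      using that by (simp add: ennreal_mult powr_realpow mult.assoc)
    finally show ?thesis
      by (simp add: add.commute flip: powr_add)
  qed
  have H_large: "H a \<le> ennreal (\<bar>a\<bar> powr (1/2 - real L)) * C" if "a \<noteq> 0" for a
  proof -
    \<comment> \<open>The substitution \<open>x = - b / a\<close>. Solved for the integral over
      \<open>b\<close>, it costs a factor \<open>\<bar>a\<bar>\<close>, so the final exponent is
      -1/2 + 1 - \<open>L\<close>.\<close>
    have "(\<integral>\<^sup>+x. ennreal (cmod (I x (1 / a))) \<partial>lborel) =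
        ennreal \<bar>- 1 / a\<bar> * (\<integral>\<^sup>+b. ennreal (cmod (I (0 + (- 1 / a) * b) (1 / a))) \<partial>lborel)"
      using that by (intro nn_integral_real_affine) auto
    then have "ennreal \<bar>a\<bar> * (\<integral>\<^sup>+x. ennreal (cmod (I x (1 / a))) \<partial>lborel) =
        ennreal (\<bar>a\<bar> * \<bar>- 1 / a\<bar>) * (\<integral>\<^sup>+b. ennreal (cmod (I (0 + (- 1 / a) * b) (1 / a))) \<partial>lborel)"
      by (simp only: ennreal_mult abs_ge_zero mult.assoc)
    also have "\<bar>a\<bar> * \<bar>- 1 / a\<bar> = 1"
      using that by simp
    finally have sub: "(\<integral>\<^sup>+b. ennreal (cmod (I (0 + (- 1 / a) * b) (1 / a))) \<partial>lborel) =
        ennreal \<bar>a\<bar> * (\<integral>\<^sup>+x. ennreal (cmod (I x (1 / a))) \<partial>lborel)"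
      by simp
    have "H a = (\<integral>\<^sup>+b. ennreal (\<bar>a\<bar> powr (-1/2)) *
        ennreal (cmod (I (0 + (- 1 / a) * b) (1 / a))) \<partial>lborel)"
      unfolding H_def W_def I_def
      by (simp only: cmod_wavelet_transform_swap[OF \<psi> \<psi>] ennreal_mult powr_ge_zero norm_ge_zero)
    also have "\<dots> = ennreal (\<bar>a\<bar> powr (-1/2)) *
        (ennreal \<bar>a\<bar> * (\<integral>\<^sup>+x. ennreal (cmod (I x (1 / a))) \<partial>lborel))"
      unfolding sub[symmetric] by (rule nn_integral_cmult) measurable
    also have "\<dots> \<le> ennreal (\<bar>a\<bar> powr (-1/2)) * (ennreal \<bar>a\<bar> * (ennreal (\<bar>1 / a\<bar> ^ L) * C))"
      by (intro mult_left_mono I_le) simp_all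
    also have "\<dots> = ennreal (\<bar>a\<bar> powr (-1/2) * \<bar>a\<bar> * \<bar>1 / a\<bar> ^ L) * C"
      by (simp add: ennreal_mult mult.assoc)
    also have "\<bar>a\<bar> powr (-1/2) * \<bar>a\<bar> * \<bar>1 / a\<bar> ^ L = \<bar>a\<bar> powr (-1/2) * \<bar>a\<bar> powr 1 * \<bar>a\<bar> powr (- real L)"
      using that by (simp add: powr_minus powr_realpow power_divide inverse_eq_divide)
    also have "\<dots> = \<bar>a\<bar> powr (1/2 - real L)"
      by (simp only: powr_add[symmetric]) simp
    finally show ?thesis .
  qed

  \<comment> \<open>The majorant from \<open>weighted_powr_bound\<close> with
    \<open>d = real L\<close>.\<close>
  define G where "G r = 2 * C * (ennreal (r powr (real L - 3/2 - \<rho>)) * indicator {0..1} r +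
    ennreal (r powr (- 3/2 - real L + \<rho>)) * indicator {1..} r)" for r :: real
  have G_meas [measurable]: "G \<in> borel_measurable borel"
    unfolding G_def by measurable
  have "(\<integral>\<^sup>+r\<in>{0..}. G r \<partial>lborel) \<le> (\<integral>\<^sup>+r. G r \<partial>lborel)"
    by (intro nn_integral_mono) (auto split: split_indicator)
  also have "\<dots> = 2 * C * ((\<integral>\<^sup>+r\<in>{0..1}. ennreal (r powr (real L - 3/2 - \<rho>)) \<partial>lborel) +
      (\<integral>\<^sup>+r\<in>{1..}. ennreal (r powr (- 3/2 - real L + \<rho>)) \<partial>lborel))"
    unfolding G_def by (simp add: nn_integral_cmult nn_integral_add)
  also have "\<dots> < \<infinity>"
  proof -
    \<comment> \<open>The exponent exceeds -1 exactly when \<open>\<rho> < real L - 1/2\<close>;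
      this is where the range of \<rho> is decided. The exponent on \<open>{1..}\<close> is below -1
      as soon as \<open>\<rho> < real L + 1/2\<close>.\<close>
    have "(\<integral>\<^sup>+r\<in>{0..1}. ennreal (r powr (real L - 3/2 - \<rho>)) \<partial>lborel) < \<infinity>"
      by (rule set_nn_integral_finite_if_has_integral[OF _ _ _ has_integral_powr_from_0])
        (use assms(8) in auto)
    moreover have "(\<integral>\<^sup>+r\<in>{1..}. ennreal (r powr (- 3/2 - real L + \<rho>)) \<partial>lborel) < \<infinity>"
      by (rule set_nn_integral_finite_if_has_integral[OF _ _ _ has_integral_powr_to_inf])
        (use assms(8) in auto)
    ultimately show ?thesis
      using C by (simp add: ennreal_mult_less_top)
  qed
  finally have G_fin: "(\<integral>\<^sup>+r\<in>{0..}. G r \<partial>lborel) < \<infinity>" .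

  define w where "w a = \<bar>a\<bar> powr \<rho> + \<bar>a\<bar> powr (- \<rho>)" for a
  have w_nonneg: "0 \<le> w a" for a
    by (simp add: w_def)
  have inner: "(\<integral>\<^sup>+b. ennreal (cmod (W (b, a)) * w a) \<partial>lborel) = H a * ennreal (w a)" for a
  proof -
    have "W \<in> borel_measurable (borel \<Otimes>\<^sub>M borel)"
      by (simp add: borel_prod)
    then show ?thesis
      unfolding H_def by (simp add: ennreal_mult w_nonneg nn_integral_multc)
  qed
  have "(\<integral>\<^sup>+a\<in>UNIV - {0}. (\<integral>\<^sup>+b. ennreal (cmod (W (b, a)) * w a) \<partial>lborel) *
      ennreal (1 / a\<^sup>2) \<partial>lborel) \<le> (\<integral>\<^sup>+a. G \<bar>a\<bar> \<partial>lborel)"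
  proof (rule nn_integral_mono)
    fix a
    show "(\<integral>\<^sup>+b. ennreal (cmod (W (b, a)) * w a) \<partial>lborel) * ennreal (1 / a\<^sup>2) *
        indicator (UNIV - {0}) a \<le> G \<bar>a\<bar>"
      using weighted_powr_bound[OF _ assms(7) H_small H_large, of a]
      unfolding inner unfolding G_def w_def by (cases "a = 0") simp_all
  qed
  also have "\<dots> \<le> 2 * (\<integral>\<^sup>+r\<in>{0..}. G r \<partial>lborel)"
    by (rule nn_integral_abs_le) measurable
  also have "\<dots> < \<infinity>"
    using G_fin by (simp add: ennreal_mult_less_top)
  finally have fin: "(\<integral>\<^sup>+a\<in>UNIV - {0}. (\<integral>\<^sup>+b. ennreal (cmod (W (b, a)) * w a) \<partial>lborel) *
      ennreal (1 / a\<^sup>2) \<partial>lborel) < \<infinity>" .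

  \<comment> \<open>A density leaves the measurable sets unchanged, so only the restriction and the
    completion have to be passed.\<close>
  have haar_meas: "F \<in> borel_measurable aff_haar" if "F \<in> borel_measurable borel"
    for F :: "real \<times> real \<Rightarrow> complex"
    using that unfolding aff_haar_def measurable_density_eq1
    by (intro measurable_restrict_space1 measurable_completion) simp
  have Ww: "(\<lambda>x. W x * of_real (aff_weight \<rho> x)) \<in> borel_measurable borel"
  proof -
    have "(\<lambda>x. W x * of_real (w (snd x))) \<in> borel_measurable (borel \<Otimes>\<^sub>M borel)"
      using W_meas unfolding w_def borel_prod[symmetric] by measurable
    then show ?thesis
      by (simp add: borel_prod aff_weight_def w_def case_prod_beta)
  qed
  \<comment> \<open>\<open>nn_integral_aff_haar\<close> identifies the integral over the group with
    the iterated integral bounded in \<open>fin\<close>.\<close>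
  have "(\<integral>\<^sup>+x. ennreal (cmod (W x * of_real (aff_weight \<rho> x))) \<partial>aff_haar) < \<infinity>"
  proof -
    have "cmod (W (b, a) * of_real (aff_weight \<rho> (b, a))) = cmod (W (b, a)) * w a" for b a
      using w_nonneg[of a] by (simp add: norm_mult aff_weight_def w_def del: of_real_add)
    moreover have "(\<lambda>x. ennreal (cmod (W x * of_real (aff_weight \<rho> x)))) \<in> borel_measurable borel"
      using Ww by measurable
    ultimately show ?thesis
      using fin by (simp only: nn_integral_aff_haar)
  qed
  then have "integrable aff_haar (\<lambda>x. W x * of_real (aff_weight \<rho> x))"
    using haar_meas[OF Ww] by (simp add: integrable_iff_bounded)
  then have "\<psi> \<in> analyzing_vectors (aff_weight \<rho>)"
    using assms(2) haar_meas[OF W_meas] by (simp add: analyzing_vectors_def L1_weighted_def W_def)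
  with fin show ?thesis
    by (simp add: nn_integral_completion W_def w_def)
qed

end
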